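(* Let $c\in\mathbb{C}$ and $r_0\ge0$, and suppose that $\overline{B}(c,r_0)=\{c'\in\mathbb{C}:|c'-c|\le r_0\}$ contains a superattracting parameter $\tilde c$. If there exist $N\in\mathbb{N}$ and $c_1,\dots,c_N\in\overline{B}(c,r_0)$ such that $f_{c_N}\circ\cdots\circ f_{c_1}$ has a parabolic periodic point, then $r_{\mathrm{bif}}(c)\le r_0$.
   Context: $f_c(z)=z^2+c$, extended to $\widehat{\mathbb{C}}$ by $f_c(\infty)=\infty$. A parameter $\tilde c$ is superattracting if $f_{\tilde c}^{\circ p}(0)=0$ for some $p\in\mathbb{N}$. A parabolic periodic point of a polynomial $g$ is a periodic point $z^*$ (with $g^{\circ q}(z^* )=z^*$) whose multiplier $(g^{\circ q})'(z^* )$ is a root of unity. For $c\in\mathbb{C}$, $r\ge0$, $G_{c,r}$ is the semigroup under composition generated by $\{f_{c'}:|c'-c|\le r\}$. A minimal set of a polynomial semigroup $G$ is a minimal element, with respect to inclusion, of the family of non-empty compact $L\subset\widehat{\mathbb{C}}$ with $g(L)\subset L$ for all $g\in G$; it is planar if $\infty\notin L$. The bifurcation radius $r_{\mathrm{bif}}(c)$ is the supremum of those $r\ge0$ for which $G_{c,r}$ has a planar minimal set (equivalently the infimum of those $r\ge0$ for which $G_{c,r}$ has no planar minimal set); by prior work this value is attained and $G_{c,r}$ has a planar minimal set iff $r\le r_{\mathrm{bif}}(c)$. *)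

theory Defs
  imports "HOL-Analysis.Analysis"
begin

definition fq :: "complex \<Rightarrow> complex \<Rightarrow> complex" where
  "fq c z = z\<^sup>2 + c"

definition superattracting :: "complex \<Rightarrow> bool" where
  "superattracting c \<longleftrightarrow> (\<exists>p::nat. p \<ge> 1 \<and> (fq c ^^ p) 0 = 0)"

definition parabolic_periodic_point :: "(complex \<Rightarrow> complex) \<Rightarrow> complex \<Rightarrow> bool" where
  "parabolic_periodic_point g z \<longleftrightarrow>
     (\<exists>q::nat. q \<ge> 1 \<and> (g ^^ q) z = z \<and>
        (\<exists>n::nat. n \<ge> 1 \<and> (deriv (g ^^ q) z) ^ n = 1))"

fun fcomp :: "complex list \<Rightarrow> complex \<Rightarrow> complex" where
  "fcomp [] = id"
| "fcomp (c # cs) = fcomp cs \<circ> fq c"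

inductive_set Gsemi :: "complex \<Rightarrow> real \<Rightarrow> (complex \<Rightarrow> complex) set"
  for c :: complex and r :: real where
  gen: "cmod (c' - c) \<le> r \<Longrightarrow> fq c' \<in> Gsemi c r"
| comp: "g \<in> Gsemi c r \<Longrightarrow> h \<in> Gsemi c r \<Longrightarrow> g \<circ> h \<in> Gsemi c r"

definition forward_invariant :: "(complex \<Rightarrow> complex) set \<Rightarrow> complex set \<Rightarrow> bool" where
  "forward_invariant G L \<longleftrightarrow> (\<forall>g\<in>G. g ` L \<subseteq> L)"

text \<open>A planar minimal set: a minimal (w.r.t. inclusion) non-empty compact forward invariant
  subset of the Riemann sphere not containing infinity. Since every subset of a planar set is
  planar, minimality among compact invariant subsets of the sphere is the same as minimality
  among compact invariant subsets of the plane.\<close>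
definition planar_minimal_set :: "(complex \<Rightarrow> complex) set \<Rightarrow> complex set \<Rightarrow> bool" where
  "planar_minimal_set G L \<longleftrightarrow>
     L \<noteq> {} \<and> compact L \<and> forward_invariant G L \<and>
     (\<forall>K. K \<noteq> {} \<and> compact K \<and> forward_invariant G K \<and> K \<subseteq> L \<longrightarrow> K = L)"

definition r_bif :: "complex \<Rightarrow> ereal" where
  "r_bif c = Sup {ereal r | r. r \<ge> 0 \<and> (\<exists>L. planar_minimal_set (Gsemi c r) L)}"

end

theory Submission
  imports Defs "HOL-Complex_Analysis.Complex_Analysis"
begin

text \<open>Let \<^term>\<open>r > r0\<close> and let \<^term>\<open>L\<close> be a non-empty compact set invariant under
  \<^term>\<open>Gsemi c r\<close>. Every map \<^term>\<open>fq a\<close> with \<^term>\<open>a \<in> cball c r0\<close> sends \<^term>\<open>L\<close> into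
  itself with margin \<^term>\<open>r - r0\<close>. The margin allows each map to be replaced by a slightly more
  expanding one that still preserves \<^term>\<open>L\<close>, so by Cauchy's inequality the derivatives of long
  compositions decay exponentially on the interior of \<^term>\<open>L\<close>.

  Inverse branches of a composition exist on every disc that avoids its critical values, and they
  are bounded because points near infinity escape. If \<^term>\<open>L\<close> missed the critical point 0, it
  would miss the whole superattracting cycle, and the bounded inverse branches along an orbit in
  \<^term>\<open>L\<close> would contradict the decay of derivatives. So 0, and with it every critical value of
  every composition, lies in \<^term>\<open>L\<close>. A parabolic point in \<^term>\<open>L\<close> contradicts the decay of
  derivatives. A parabolic point outside \<^term>\<open>L\<close> has a disc on which the inverse branches of all
  iterates exist and are bounded, whereas their first non-linear coefficient grows linearly with
  the iterate.\<close>

section \<open>Compositions of quadratic maps\<close>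

lemma fcomp_append: "fcomp (xs @ ys) = fcomp ys \<circ> fcomp xs"
  by (induction xs) (auto simp: fun_eq_iff)

lemma fcomp_concat_replicate: "fcomp (concat (replicate m xs)) = fcomp xs ^^ m"
  by (induction m) (auto simp: fcomp_append fun_eq_iff funpow_swap1)

lemma fcomp_replicate: "fcomp (replicate m a) = fq a ^^ m"
  by (induction m) (auto simp: fun_eq_iff funpow_swap1)

lemma has_field_derivative_fq: "(fq a has_field_derivative 2 * z) (at z)"
  unfolding fq_def by (auto intro!: derivative_eq_intros)

lemma holomorphic_fcomp: "fcomp cs holomorphic_on S"
proof (induction cs arbitrary: S)
  case (Cons a cs)
  have "fq a holomorphic_on S"
    unfolding fq_def by (intro holomorphic_intros)
  from holomorphic_on_compose[OF this Cons.IH] show ?case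
    by (simp add: o_def)
qed (simp add: id_def)

lemma field_differentiable_fcomp: "fcomp cs field_differentiable at z"
  using holomorphic_fcomp[of cs UNIV] by (simp add: holomorphic_on_def)

lemma has_field_derivative_funpow_fixpoint:
  fixes f :: "complex \<Rightarrow> complex"
  assumes "f z = z" "(f has_field_derivative l) (at z)"
  shows "((f ^^ m) has_field_derivative l ^ m) (at z)"
proof (induction m)
  case (Suc m)
  have "(f ^^ m) z = z" by (induction m) (auto simp: assms(1))
  then have "(f has_field_derivative l) (at ((f ^^ m) z))" using assms(2) by simp
  from DERIV_chain[OF this Suc] show ?case by (simp only: funpow.simps power_Suc)
qed (simp add: id_def)

text \<open>Escape near infinity: from modulus \<open>C + 2\<close> on, squaring gains at least
  \<open>C + 1\<close>, which pays for \<open>cmod a\<close> and still leaves 1.\<close>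

lemma norm_fq_ge:
  assumes "cmod a \<le> C" "C + 2 \<le> cmod v"
  shows "cmod v + 1 \<le> cmod (fq a v)"
proof -
  have "0 \<le> C" using assms(1) norm_ge_zero order_trans by blast
  then have "(C + 2) * (C + 1) \<le> cmod v * (cmod v - 1)"
    using assms(2) by (intro mult_mono) auto
  moreover have "C + 1 \<le> (C + 2) * (C + 1)"
    using \<open>0 \<le> C\<close> by (simp add: algebra_simps)
  moreover have "cmod v ^ 2 - cmod a \<le> cmod (fq a v)"
    unfolding fq_def by (metis norm_diff_ineq norm_power)
  ultimately show ?thesis
    using assms(1) by (simp add: algebra_simps power2_eq_square)
qed

lemma norm_fcomp_ge:
  assumes "\<forall>a\<in>set cs. cmod a \<le> C" "C + 2 \<le> cmod v"
  shows "cmod v + length cs \<le> cmod (fcomp cs v)"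
  using assms
proof (induction cs arbitrary: v)
  case (Cons a cs)
  have "cmod v + 1 \<le> cmod (fq a v)"
    using norm_fq_ge[of a C v] Cons.prems by auto
  moreover have "cmod (fq a v) + length cs \<le> cmod (fcomp cs (fq a v))"
    using Cons.IH[of "fq a v"] Cons.prems calculation by auto
  ultimately show ?case by simp
qed simp

lemma ex_norm_bound_set_list:
  obtains C where "\<forall>a\<in>set cs. cmod a \<le> C"
proof -
  have "bounded (set cs)" by (simp add: finite_imp_bounded)
  then show ?thesis using that by (auto simp: bounded_iff)
qed

text \<open>The fixed point would make the constant 0 and the map the identity, but large points
  move outward. Hence the difference has a zero of finite order at \<open>z\<close>.\<close>

lemma fcomp_minus_id_not_constant:
  assumes "cs \<noteq> []" "fcomp cs z = z"
  shows "\<not> (\<lambda>w. fcomp cs w - w) constant_on UNIV"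
proof
  assume "(\<lambda>w. fcomp cs w - w) constant_on UNIV"
  then have eq: "fcomp cs w = w" for w
    using assms(2) unfolding constant_on_def by (metis UNIV_I eq_iff_diff_eq_0)
  obtain C where C: "\<forall>a\<in>set cs. cmod a \<le> C" by (rule ex_norm_bound_set_list)
  have "C + 2 \<le> cmod (of_real (\<bar>C\<bar> + 2))" by (simp only: norm_of_real)
  from norm_fcomp_ge[OF C this] show False
    using assms(1) by (simp add: eq)
qed

section \<open>Inverse branches\<close>

text \<open>The critical values of \<^term>\<open>fcomp cs\<close> are the points \<^term>\<open>fcomp (a # ys) 0\<close> with
  \<^term>\<open>a # ys\<close> a suffix of \<^term>\<open>cs\<close>.\<close>

lemma fcomp_inverse_branch:
  assumes "contractible S" "fcomp cs w \<in> S"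
    and "\<And>xs a ys. cs = xs @ a # ys \<Longrightarrow> fcomp (a # ys) 0 \<notin> S"
  obtains h where "h holomorphic_on S" "h (fcomp cs w) = w" "\<And>u. u \<in> S \<Longrightarrow> fcomp cs (h u) = u"
  using assms(2,3)
proof (induction cs arbitrary: w thesis)
  case Nil
  show ?case by (rule Nil.prems(1)[of id]) (auto simp: id_def)
next
  case (Cons a cs)
  have avoid: "fcomp (b # ys) 0 \<notin> S" if "cs = xs @ b # ys" for xs b ys
    using Cons.prems(3)[of "a # xs" b ys] that by simp
  obtain k where k: "k holomorphic_on S" "k (fcomp cs (fq a w)) = fq a w"
      "\<And>u. u \<in> S \<Longrightarrow> fcomp cs (k u) = u"
    using Cons.IH[of "fq a w"] Cons.prems(2) avoid by auto
  \<comment> \<open>A zero would give \<open>k u = fq a 0\<close>, so the critical value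
    \<open>fcomp (a # cs) 0\<close> would equal \<open>u\<close> and lie in
    \<open>S\<close>.\<close>
  have "k u - a \<noteq> 0" if "u \<in> S" for u
    using Cons.prems(3)[of "[]" a cs] k(3)[OF that] that by (auto simp: fq_def)
  moreover have "(\<lambda>u. k u - a) holomorphic_on S"
    by (intro holomorphic_intros k)
  ultimately obtain s where s: "s holomorphic_on S" "\<And>u. u \<in> S \<Longrightarrow> k u - a = s u ^ 2"
    using contractible_imp_holomorphic_sqrt[OF _ assms(1), of "\<lambda>u. k u - a"] by metis
  let ?u0 = "fcomp (a # cs) w"
  have "s ?u0 ^ 2 = w ^ 2"
    using s(2)[OF Cons.prems(2)] k(2) by (simp add: fq_def)
  \<comment> \<open>The square root is fixed up to sign; \<open>e\<close> selects the branch
    returning to \<open>w\<close>.\<close>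
  then obtain e :: complex where e: "e ^ 2 = 1" "e * s ?u0 = w"
    by (metis mult_1 mult_minus1 power2_eq_iff power2_minus power_one minus_minus)
  show ?case
  proof (rule Cons.prems(1)[of "\<lambda>u. e * s u"])
    show "(\<lambda>u. e * s u) holomorphic_on S" by (intro holomorphic_intros s)
    show "fcomp (a # cs) (e * s u) = u" if "u \<in> S" for u
      using k(3)[OF that] s(2)[OF that] e(1)
      by (simp add: fq_def power_mult_distrib algebra_simps flip: s(2)[OF that])
  qed (use e in auto)
qed

text \<open>By escape, a preimage beyond \<open>R\<close> would have its image beyond
  \<open>R\<close>. The bound is uniform in the length of \<open>cs\<close>.\<close>

lemma norm_fcomp_inverse_branch_le:
  assumes "\<forall>a\<in>set cs. cmod a \<le> C" "fcomp cs v = u" "cmod u \<le> R" "C + 2 \<le> R"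
  shows "cmod v \<le> R"
  using norm_fcomp_ge[OF assms(1), of v] assms(2-) by fastforce

lemma norm_deriv_le_of_bounded:
  assumes "f holomorphic_on ball z d" "0 < d" "\<And>w. w \<in> ball z d \<Longrightarrow> cmod (f w) \<le> B"
  shows "cmod (deriv f z) \<le> 2 * B / d"
proof -
  \<comment> \<open>The radius is halved because \<open>f\<close> is controlled only on the open
    disc; hence the factor 2.\<close>
  have "cmod ((deriv ^^ 1) f z) \<le> fact 1 * B / (d / 2) ^ 1"
  proof (rule Cauchy_inequality)
    show "f holomorphic_on ball z (d / 2)"
      using assms by (auto intro: holomorphic_on_subset)
    show "continuous_on (cball z (d / 2)) f"
      by (rule holomorphic_on_imp_continuous_on, rule holomorphic_on_subset[OF assms(1)])
        (use assms in auto)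
    show "cmod (f x) \<le> B" if "cmod (z - x) = d / 2" for x
      using assms that by (auto simp: dist_norm)
  qed (use assms in auto)
  then show ?thesis by (simp add: mult.commute)
qed

section \<open>A quantitative form of Cartan's uniqueness theorem\<close>

text \<open>Each iteration adds another \<open>a\<close>: the difference telescopes through
  \<open>F w\<close>, and \<open>(F w - z) / (w - z)\<close> tends to 1. \<open>inj\<close> keeps
  \<open>F w\<close> in the punctured neighbourhood.\<close>

lemma tendsto_funpow_minus_id:
  fixes F :: "complex \<Rightarrow> complex"
  assumes fix_z: "F z = z" and der: "(F has_field_derivative 1) (at z)"
    and inj: "eventually (\<lambda>w. F w \<noteq> z) (at z)"
    and lim: "((\<lambda>w. (F w - w) / (w - z) ^ k) \<longlongrightarrow> a) (at z)"
  shows "((\<lambda>w. ((F ^^ m) w - w) / (w - z) ^ k) \<longlongrightarrow> of_nat m * a) (at z)"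
proof (induction m)
  case (Suc m)
  have cont: "(F \<longlongrightarrow> z) (at z)"
    using DERIV_isCont[OF der] fix_z by (simp add: isCont_def)
  have flim: "filterlim F (at z) (at z)"
    using cont inj by (simp add: filterlim_at)
  have "((\<lambda>w. (F w - z) / (w - z)) \<longlongrightarrow> 1) (at z)"
    using der fix_z by (simp add: has_field_derivative_iff)
  then have "((\<lambda>w. ((F ^^ m) (F w) - F w) / (F w - z) ^ k * ((F w - z) / (w - z)) ^ k
       + (F w - w) / (w - z) ^ k) \<longlongrightarrow> of_nat m * a * 1 ^ k + a) (at z)"
    by (intro tendsto_intros lim filterlim_compose[OF Suc.IH flim])
  moreover have "eventually (\<lambda>w. ((F ^^ m) (F w) - F w) / (F w - z) ^ k * ((F w - z) / (w - z)) ^ k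
       + (F w - w) / (w - z) ^ k = ((F ^^ Suc m) w - w) / (w - z) ^ k) (at z)"
    using inj eventually_neq_at_within[of z z UNIV]
    by eventually_elim (auto simp: power_divide funpow_swap1 simp flip: add_divide_distrib)
  ultimately show ?case
    by (simp add: tendsto_cong algebra_simps)
qed simp

text \<open>The quotient extends across \<open>z\<close> with value \<open>b\<close>, which the
  maximum principle on the disc of radius \<open>d / 2\<close> bounds.\<close>

lemma norm_leading_coeff_le:
  fixes f :: "complex \<Rightarrow> complex"
  assumes hol: "f holomorphic_on ball z d" and "0 < d"
    and bound: "\<And>w. w \<in> ball z d \<Longrightarrow> cmod (f w) \<le> B"
    and lim: "((\<lambda>w. f w / (w - z) ^ k) \<longlongrightarrow> b) (at z)"
  shows "cmod b \<le> B / (d / 2) ^ k"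
proof -
  let ?g = "\<lambda>w. if w = z then b else f w / (w - z) ^ k"
  have "(\<lambda>w. f w / (w - z) ^ k) holomorphic_on ball z d - {z}"
    by (intro holomorphic_intros holomorphic_on_subset[OF hol]) auto
  then have g: "?g holomorphic_on ball z d"
    by (rule removable_singularity) (use lim in auto)
  have "cmod (?g z) \<le> B / (d / 2) ^ k"
  proof (rule maximum_modulus_frontier[of ?g "cball z (d / 2)"])
    show "?g holomorphic_on interior (cball z (d / 2))"
      by (rule holomorphic_on_subset[OF g]) (use \<open>0 < d\<close> in auto)
    show "continuous_on (closure (cball z (d / 2))) ?g"
      by (rule holomorphic_on_imp_continuous_on, rule holomorphic_on_subset[OF g])
        (use \<open>0 < d\<close> in auto)
    show "cmod (?g w) \<le> B / (d / 2) ^ k" if "w \<in> frontier (cball z (d / 2))" for w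
    proof -
      have w: "cmod (w - z) = d / 2"
        using that \<open>0 < d\<close> by (simp add: dist_norm norm_minus_commute)
      then have "w \<noteq> z" "w \<in> ball z d" using \<open>0 < d\<close> by (auto simp: dist_norm norm_minus_commute)
      then show ?thesis
        using bound[of w] \<open>0 < d\<close> by (simp add: norm_divide norm_power w divide_right_mono)
    qed
  qed (use \<open>0 < d\<close> in auto)
  then show ?thesis by simp
qed

lemma no_bounded_inverse_branches:
  fixes F :: "complex \<Rightarrow> complex"
  assumes hol: "F holomorphic_on UNIV" and nonconst: "\<not> (\<lambda>w. F w - w) constant_on UNIV"
    and fix_z: "F z = z" and der: "(F has_field_derivative 1) (at z)" and "0 < d"
    and h_hol: "\<And>m. h m holomorphic_on ball z d"
    and h_z: "\<And>m. h m z = z"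
    and inv: "\<And>m u. u \<in> ball z d \<Longrightarrow> (F ^^ m) (h m u) = u"
    and bound: "\<And>m u. u \<in> ball z d \<Longrightarrow> cmod (h m u) \<le> R"
  shows False
proof -
  have "(\<lambda>w. F w - w) holomorphic_on UNIV" by (intro holomorphic_intros hol)
  \<comment> \<open>\<open>k\<close> is the order of the zero of \<open>F w - w\<close> at
    \<open>z\<close>, and \<open>g z\<close> its leading coefficient.\<close>
  then obtain g r k where g: "0 < r" "g holomorphic_on ball z r"
      "\<And>w. w \<in> ball z r \<Longrightarrow> F w - w = (w - z) ^ k * g w"
      "\<And>w. w \<in> ball z r \<Longrightarrow> g w \<noteq> 0"
    by (rule holomorphic_factor_zero_nonconstant[of "\<lambda>w. F w - w" UNIV z])
      (use fix_z nonconst in auto)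
  define a where "a = g z"
  have "a \<noteq> 0" using g by (simp add: a_def)
  have "isCont g z"
    using g(1,2) continuous_on_interior holomorphic_on_imp_continuous_on
    by (metis centre_in_ball interior_open open_ball)
  then have "(g \<longlongrightarrow> a) (at z)" by (simp add: isCont_def a_def)
  moreover have "eventually (\<lambda>w. g w = (F w - w) / (w - z) ^ k) (at z)"
    using eventually_at_ball[OF g(1), of z UNIV] eventually_neq_at_within[of z z UNIV]
    by eventually_elim (use g(3) in auto)
  ultimately have lim: "((\<lambda>w. (F w - w) / (w - z) ^ k) \<longlongrightarrow> a) (at z)"
    by (simp add: tendsto_cong)
  have quot: "((\<lambda>w. (F w - z) / (w - z)) \<longlongrightarrow> 1) (at z)"
    using der fix_z by (simp add: has_field_derivative_iff)
  then have inj: "eventually (\<lambda>w. F w \<noteq> z) (at z)"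
    using tendsto_imp_eventually_ne[OF quot, of 0] by (auto elim!: eventually_mono)
  have iter_der: "((F ^^ m) has_field_derivative 1) (at z)" for m
    using has_field_derivative_funpow_fixpoint[OF fix_z der, of m] by simp
  have iter_z: "(F ^^ m) z = z" for m by (induction m) (auto simp: fix_z)
  have key: "cmod (of_nat m * a) \<le> (R + cmod z + d) / (d / 2) ^ k" for m
  proof -
    have h_lim: "(h m \<longlongrightarrow> z) (at z)"
      using h_hol[of m] \<open>0 < d\<close> h_z[of m]
      by (metis at_within_open centre_in_ball continuous_on holomorphic_on_imp_continuous_on open_ball)
    have ball_z: "eventually (\<lambda>u. u \<in> ball z d \<and> u \<noteq> z) (at z)"
      using eventually_at_ball[OF \<open>0 < d\<close>, of z UNIV] eventually_neq_at_within[of z z UNIV]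
      by eventually_elim auto
    then have h_ne: "eventually (\<lambda>u. h m u \<noteq> z) (at z)"
      by eventually_elim (use inv iter_z in metis)
    have h_at: "filterlim (h m) (at z) (at z)"
      using h_lim h_ne by (simp add: filterlim_at)
    have "((\<lambda>w. ((F ^^ m) w - z) / (w - z)) \<longlongrightarrow> 1) (at z)"
      using iter_der[of m] iter_z[of m] by (simp add: has_field_derivative_iff)
    \<comment> \<open>For \<open>w\<close> near \<open>z\<close> the quotient is
      \<open>- ((F ^^ m) w - w) / ((F ^^ m) w - z) ^ k\<close>. Putting \<open>w = h m u\<close>, so
      that \<open>(F ^^ m) w = u\<close>, shows that \<open>h m\<close> has leading coefficient
      \<open>- (of_nat m * a)\<close>.\<close>
    then have "((\<lambda>w. - (((F ^^ m) w - w) / (w - z) ^ k) / (((F ^^ m) w - z) / (w - z)) ^ k)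
        \<longlongrightarrow> - (of_nat m * a) / 1 ^ k) (at z)"
      by (intro tendsto_intros tendsto_funpow_minus_id fix_z der inj lim) auto
    note lim_h = filterlim_compose[OF this h_at]
    have "((\<lambda>u. (h m u - u) / (u - z) ^ k) \<longlongrightarrow> - (of_nat m * a) / 1 ^ k) (at z)"
    proof (rule Lim_transform_eventually[OF lim_h])
      show "eventually (\<lambda>u. - (((F ^^ m) (h m u) - h m u) / (h m u - z) ^ k) /
          (((F ^^ m) (h m u) - z) / (h m u - z)) ^ k = (h m u - u) / (u - z) ^ k) (at z)"
        using ball_z h_ne by eventually_elim (simp add: inv power_divide flip: minus_divide_left)
    qed
    then have "cmod (- (of_nat m * a) / 1 ^ k) \<le> (R + cmod z + d) / (d / 2) ^ k"
    proof (rule norm_leading_coeff_le[rotated 3])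
      show "(\<lambda>u. h m u - u) holomorphic_on ball z d" by (intro holomorphic_intros h_hol)
      show "cmod (h m u - u) \<le> R + cmod z + d" if "u \<in> ball z d" for u
        using bound[OF that, of m] that norm_triangle_ineq4[of "h m u" u]
          norm_triangle_ineq2[of u z] by (simp add: dist_norm norm_minus_commute)
    qed (fact \<open>0 < d\<close>)
    then show ?thesis by simp
  qed
  obtain m :: nat where "(R + cmod z + d) / (d / 2) ^ k < of_nat m * cmod a"
    using reals_Archimedean3[of "cmod a"] \<open>a \<noteq> 0\<close> by auto
  with key[of m] show False by (simp add: norm_mult)
qed

section \<open>Absorbing sets\<close>

text \<open>\<open>A\<close> holds the parameters of the maps being composed; the margin
  \<open>\<epsilon>\<close> is the room left by invariance of \<open>L\<close> under a larger
  parameter disc.\<close>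

locale absorbing =
  fixes A L :: "complex set" and \<epsilon> :: real
  assumes compact: "compact L" and nonempty: "L \<noteq> {}" and eps_pos: "0 < \<epsilon>"
    and absorb: "\<And>a w. a \<in> A \<Longrightarrow> w \<in> L \<Longrightarrow> cball (fq a w) \<epsilon> \<subseteq> L"
begin

lemma fq_in: "a \<in> A \<Longrightarrow> w \<in> L \<Longrightarrow> fq a w \<in> L"
  using absorb[of a w] eps_pos by (auto simp: subset_iff)

lemma fcomp_in: "set cs \<subseteq> A \<Longrightarrow> w \<in> L \<Longrightarrow> fcomp cs w \<in> L"
  by (induction cs arbitrary: w) (auto intro: fq_in)

lemma fcomp_in_interior:
  assumes "set cs \<subseteq> A" "w \<in> L" "cs \<noteq> []"
  shows "fcomp cs w \<in> interior L"
proof -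
  obtain as b where cs: "cs = as @ [b]" using assms(3) rev_exhaust by blast
  have "ball (fcomp cs w) \<epsilon> \<subseteq> L"
    using absorb[of b "fcomp as w"] fcomp_in[of as w] assms ball_subset_cball
    by (auto simp: cs fcomp_append)
  then show ?thesis
    using eps_pos centre_in_ball mem_interior by blast
qed

text \<open>Replacing each factor \<^term>\<open>fq a\<close> by \<^term>\<open>\<lambda>u. fq a u + t * (fq a u - fq a w)\<close> keeps the
  orbit of \<^term>\<open>w\<close> and the invariance of \<^term>\<open>L\<close> but multiplies the derivative along the orbit
  by \<^term>\<open>1 + t\<close> at each step.\<close>

lemma expanding_perturbation:
  assumes t: "\<And>u v. u \<in> L \<Longrightarrow> v \<in> L \<Longrightarrow> \<bar>t\<bar> * cmod (u - v) \<le> \<epsilon>"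
    and "set cs \<subseteq> A" "w \<in> L"
  obtains g where "g holomorphic_on UNIV" "g ` L \<subseteq> L"
    "deriv g w = of_real ((1 + t) ^ length cs) * deriv (fcomp cs) w" "g w = fcomp cs w"
  using assms(2,3)
proof (induction cs arbitrary: w thesis)
  case Nil
  show ?case by (rule Nil.prems(1)[of id]) (auto simp: id_def)
next
  case (Cons a cs)
  let ?b = "fq a w"
  obtain g where g: "g holomorphic_on UNIV" "g ` L \<subseteq> L"
      "deriv g ?b = of_real ((1 + t) ^ length cs) * deriv (fcomp cs) ?b" "g ?b = fcomp cs ?b"
    using Cons.IH[of ?b] Cons.prems fq_in by auto
  let ?p = "\<lambda>u. fq a u + of_real t * (fq a u - ?b)"
  have p_der: "(?p has_field_derivative of_real (1 + t) * (2 * w)) (at w)"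
    by (auto intro!: derivative_eq_intros has_field_derivative_fq simp: algebra_simps)
  have p_in: "?p u \<in> L" if "u \<in> L" for u
  proof -
    have "?p u \<in> cball (fq a u) \<epsilon>"
      using t[of "fq a u" ?b] that Cons.prems fq_in by (auto simp: dist_norm norm_mult)
    then show ?thesis using absorb[of a u] that Cons.prems by auto
  qed
  have p_b: "?p w = ?b" by simp
  show ?case
  proof (rule Cons.prems(1)[of "g \<circ> ?p"])
    have "?p holomorphic_on UNIV" unfolding fq_def by (intro holomorphic_intros)
    then show "g \<circ> ?p holomorphic_on UNIV"
      by (rule holomorphic_on_compose) (use g(1) holomorphic_on_subset in blast)
    show "(g \<circ> ?p) ` L \<subseteq> L" using g(2) p_in by auto
    have "(g has_field_derivative deriv g ?b) (at (?p w))"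
      using g(1) unfolding p_b by (auto intro: holomorphic_derivI)
    then have "deriv (g \<circ> ?p) w = deriv g ?b * (of_real (1 + t) * (2 * w))"
      by (intro DERIV_imp_deriv DERIV_chain p_der)
    moreover have "deriv (fcomp (a # cs)) w = deriv (fcomp cs) ?b * (2 * w)"
      unfolding fcomp.simps
      by (intro DERIV_imp_deriv DERIV_chain has_field_derivative_fq)
        (simp add: DERIV_deriv_iff_field_differentiable field_differentiable_fcomp)
    ultimately show "deriv (g \<circ> ?p) w =
        of_real ((1 + t) ^ length (a # cs)) * deriv (fcomp (a # cs)) w"
      by (simp add: g(3))
  qed (use g(4) in simp)
qed

text \<open>The perturbed map still sends a disc about \<open>w\<close> into \<open>L\<close>, so
  Cauchy bounds its derivative independently of \<open>cs\<close>. The decay of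
  \<open>deriv (fcomp cs) w\<close> has to offset the stretching factor.\<close>

lemma deriv_fcomp_le:
  assumes "w \<in> interior L"
  obtains K q where "1 < q" "\<And>cs. set cs \<subseteq> A \<Longrightarrow> q ^ length cs * cmod (deriv (fcomp cs) w) \<le> K"
proof -
  obtain B where B: "0 < B" "\<And>u. u \<in> L \<Longrightarrow> cmod u \<le> B"
    using compact_imp_bounded[OF compact] by (auto simp: bounded_pos)
  obtain d where d: "0 < d" "ball w d \<subseteq> L" using assms mem_interior by blast
  \<comment> \<open>\<open>2 * B\<close> bounds the diameter of \<open>L\<close>, so stretching by
    \<open>t\<close> displaces points by at most \<open>\<epsilon>\<close>.\<close>
  define t where "t = \<epsilon> / (2 * B)"
  have "0 < t" using eps_pos B(1) by (simp add: t_def)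
  have t: "\<bar>t\<bar> * cmod (u - v) \<le> \<epsilon>" if "u \<in> L" "v \<in> L" for u v
  proof -
    have "cmod (u - v) \<le> 2 * B"
      using B(2)[OF that(1)] B(2)[OF that(2)] norm_triangle_ineq4[of u v] by simp
    then have "t * cmod (u - v) \<le> t * (2 * B)"
      using \<open>0 < t\<close> by (intro mult_left_mono) auto
    then show ?thesis using \<open>0 < t\<close> B(1) eps_pos by (simp add: t_def)
  qed
  have wL: "w \<in> L" using assms interior_subset by blast
  show ?thesis
  proof (rule that)
    show "1 < 1 + t" using \<open>0 < t\<close> by simp
    fix cs assume "set cs \<subseteq> A"
    then obtain g where g: "g holomorphic_on UNIV" "g ` L \<subseteq> L"
        "deriv g w = of_real ((1 + t) ^ length cs) * deriv (fcomp cs) w"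
      using expanding_perturbation[OF t _ wL] by metis
    have "cmod (g u) \<le> B" if "u \<in> ball w d" for u
      using g(2) d(2) B(2) that by blast
    then have "cmod (deriv g w) \<le> 2 * B / d"
      by (intro norm_deriv_le_of_bounded holomorphic_on_subset[OF g(1)]) (use d in auto)
    then show "(1 + t) ^ length cs * cmod (deriv (fcomp cs) w) \<le> 2 * B / d"
      using \<open>0 < t\<close> by (simp add: g(3) norm_mult norm_power)
        (metis abs_of_pos add_pos_pos norm_of_real of_real_1 of_real_add zero_less_one)
  qed
qed

lemma zero_in_if_superattracting:
  assumes "superattracting a" "a \<in> A"
  shows "0 \<in> L"
proof (rule ccontr)
  assume "0 \<notin> L"
  obtain p where p: "p \<ge> 1" "(fq a ^^ p) 0 = 0"
    using assms(1) by (auto simp: superattracting_def)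
  \<comment> \<open>The critical orbit contains all critical values of the iterates; being a finite
    cycle, it stays a positive distance from \<open>L\<close> once disjoint from it.\<close>
  define P where "P = range (\<lambda>j. (fq a ^^ j) 0)"
  have "P \<subseteq> (\<lambda>j. (fq a ^^ j) 0) ` {..<p}"
  proof
    fix x assume "x \<in> P"
    then obtain j where "x = (fq a ^^ j) 0" by (auto simp: P_def)
    then have "x = (fq a ^^ (j mod p)) 0" using funpow_mod_eq[OF p(2), of j] by simp
    then show "x \<in> (\<lambda>j. (fq a ^^ j) 0) ` {..<p}" using p(1) by auto
  qed
  then have "closed P" by (meson finite_imageI finite_imp_closed finite_lessThan finite_subset)
  have iter_in: "(fq a ^^ m) w \<in> L" if "w \<in> L" for m w
    using fcomp_in[of "replicate m a" w] that assms(2)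
    by (auto simp: fcomp_replicate set_replicate_conv_if split: if_splits)
  have "(fq a ^^ j) 0 \<notin> L" for j
  proof
    assume "(fq a ^^ j) 0 \<in> L"
    \<comment> \<open>As \<open>p\<close> is at least 1, these further steps complete
      \<open>j\<close> full periods and return to 0.\<close>
    then have "(fq a ^^ (j * p - j)) ((fq a ^^ j) 0) \<in> L" by (rule iter_in)
    moreover have "(fq a ^^ (j * p - j)) ((fq a ^^ j) 0) = (fq a ^^ (j * p)) 0"
      using p(1) funpow_add[of "j * p - j" j "fq a"] by (simp add: le_add_diff_inverse2)
    moreover have "(fq a ^^ (j * p)) 0 = 0"
      using funpow_mod_eq[OF p(2), of "j * p"] by simp
    ultimately show False using \<open>0 \<notin> L\<close> by simp
  qed
  then have "L \<inter> P = {}" by (auto simp: P_def)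
  then obtain d where d: "0 < d" "\<And>x y. x \<in> L \<Longrightarrow> y \<in> P \<Longrightarrow> d \<le> dist x y"
    using separate_compact_closed[OF compact \<open>closed P\<close>] by metis
  obtain w0 where "w0 \<in> L" using nonempty by blast
  define w where "w = fq a w0"
  have w: "w \<in> interior L"
    using fcomp_in_interior[of "[a]" w0] assms(2) \<open>w0 \<in> L\<close> by (simp add: w_def)
  then have wL: "w \<in> L" using interior_subset by blast
  obtain K q where Kq: "1 < q" "\<And>cs. set cs \<subseteq> A \<Longrightarrow> q ^ length cs * cmod (deriv (fcomp cs) w) \<le> K"
    using deriv_fcomp_le[OF w] by blast
  obtain B where B: "0 < B" "\<And>u. u \<in> L \<Longrightarrow> cmod u \<le> B"
    using compact_imp_bounded[OF compact] by (auto simp: bounded_pos)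
  \<comment> \<open>\<open>B + d\<close> covers discs of radius \<open>d\<close> about points of
    \<open>L\<close>; \<open>cmod a + 2\<close> is the escape threshold.\<close>
  define R where "R = B + d + cmod a + 2"
  have "q ^ m \<le> 2 * R / d * K" for m
  proof -
    define cs where "cs = replicate m a"
    define u where "u = fcomp cs w"
    have csA: "set cs \<subseteq> A" using assms(2) by (auto simp: cs_def)
    then have uL: "u \<in> L" using fcomp_in wL by (simp add: u_def)
    have avoid: "fcomp (b # ys) 0 \<notin> ball u d" if "cs = xs @ b # ys" for xs b ys
    proof -
      have "b # ys = replicate (length (b # ys)) a"
        using that by (intro replicate_eqI) (auto simp: cs_def dest!: arg_cong[where f = set] split: if_splits)
      then have "fcomp (b # ys) 0 \<in> P" by (metis fcomp_replicate P_def rangeI)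
      then show ?thesis using d(2)[OF uL] by (meson mem_ball not_le)
    qed
    obtain h where h: "h holomorphic_on ball u d" "h u = w" "\<And>v. v \<in> ball u d \<Longrightarrow> fcomp cs (h v) = v"
      by (rule fcomp_inverse_branch[of "ball u d" cs w])
        (use avoid d(1) in \<open>auto simp: u_def convex_imp_contractible\<close>)
    have "cmod (h v) \<le> R" if "v \<in> ball u d" for v
    proof (rule norm_fcomp_inverse_branch_le[of cs "cmod a" _ v])
      show "cmod v \<le> R"
        using that B(2)[OF uL] norm_triangle_ineq2[of v u]
        by (simp add: R_def dist_norm norm_minus_commute) (smt (verit) norm_ge_zero)
    qed (use h(3)[OF that] B(1) d(1) in \<open>auto simp: cs_def R_def\<close>)
    then have h_le: "cmod (deriv h u) \<le> 2 * R / d"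
      using norm_deriv_le_of_bounded[OF h(1) d(1)] by blast
    \<comment> \<open>Differentiating \<open>fcomp cs (h v) = v\<close> turns the bound on
      \<open>deriv h u\<close> into a lower bound for \<open>deriv (fcomp cs) w\<close>, against its
      decay.\<close>
    have "(fcomp cs \<circ> h has_field_derivative deriv (fcomp cs) (h u) * deriv h u) (at u)"
      using h(1) d(1)
      by (intro DERIV_chain holomorphic_derivI[of h "ball u d"])
        (auto simp: DERIV_deriv_iff_field_differentiable field_differentiable_fcomp)
    then have "((\<lambda>v. v) has_field_derivative deriv (fcomp cs) w * deriv h u) (at u)"
      unfolding h(2)
      by (rule has_field_derivative_transform_within[OF _ d(1)])
        (use h in \<open>auto simp: dist_commute\<close>)
    then have "deriv (fcomp cs) w * deriv h u = 1"
      using DERIV_ident DERIV_unique by blast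
    then have "q ^ m = q ^ length cs * cmod (deriv (fcomp cs) w) * cmod (deriv h u)"
      by (simp add: cs_def flip: norm_mult mult.assoc)
    also have "\<dots> \<le> K * (2 * R / d)"
    proof (rule mult_mono)
      show "0 \<le> K" using Kq(2)[of "[]"] by (auto intro: order_trans[rotated])
    qed (use Kq(2)[OF csA] h_le in auto)
    finally show ?thesis by (simp add: mult.commute)
  qed
  moreover obtain m where "2 * R / d * K < q ^ m"
    using real_arch_pow[OF Kq(1)] by blast
  ultimately show False by (meson not_le)
qed

lemma no_fixed_point_with_multiplier_one:
  assumes cs: "set cs \<subseteq> A" "cs \<noteq> []" and zero: "0 \<in> L"
    and fix_z: "fcomp cs z = z" and der: "(fcomp cs has_field_derivative 1) (at z)"
  shows False
proof -
  define rep where "rep m = concat (replicate m cs)" for m :: nat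
  have rep: "fcomp (rep m) = fcomp cs ^^ m" "set (rep m) \<subseteq> set cs" for m
    by (auto simp: rep_def fcomp_concat_replicate)
  have rep_z: "fcomp (rep m) z = z" for m
    unfolding rep by (induction m) (auto simp: fix_z)
  show False
  proof (cases "z \<in> L")
    case True
    then have "z \<in> interior L" using fcomp_in_interior[OF cs(1) _ cs(2)] fix_z by metis
    then obtain K q where Kq: "1 < q"
        "\<And>cs. set cs \<subseteq> A \<Longrightarrow> q ^ length cs * cmod (deriv (fcomp cs) z) \<le> K"
      using deriv_fcomp_le by blast
    have "(fcomp (rep m) has_field_derivative 1) (at z)" for m
      using has_field_derivative_funpow_fixpoint[OF fix_z der, of m] by (simp add: rep)
    then have d1: "deriv (fcomp (rep m)) z = 1" for m using DERIV_imp_deriv by blast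
    have len: "m \<le> length (rep m)" for m
    proof (induction m)
      case (Suc m)
      moreover have "1 \<le> length cs" using cs(2) by (cases cs) auto
      ultimately show ?case by (simp add: rep_def)
    qed simp
    have "q ^ m \<le> K" for m
    proof -
      have "q ^ m \<le> q ^ length (rep m)" using Kq(1) len by (intro power_increasing) auto
      also have "\<dots> \<le> K" using Kq(2)[of "rep m"] d1[of m] rep(2)[of m] cs(1) by auto
      finally show ?thesis .
    qed
    then show False using real_arch_pow[OF Kq(1), of K] by (meson not_le)
  next
    case False
    obtain d where d: "0 < d" "ball z d \<inter> L = {}"
      using False compact_imp_closed[OF compact]
      by (metis ComplI Compl_disjoint2 disjoint_eq_subset_Compl inf.commute open_Compl open_contains_ball)
    obtain C where C: "\<forall>a\<in>set cs. cmod a \<le> C" by (rule ex_norm_bound_set_list)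
    define R where "R = \<bar>C\<bar> + 2 + cmod z + d"
    have "\<exists>h. h holomorphic_on ball z d \<and> h z = z \<and> (\<forall>u\<in>ball z d. fcomp (rep m) (h u) = u)" for m
    proof -
      \<comment> \<open>Critical values are images of 0 under words over \<open>A\<close>, hence lie
        in \<open>L\<close>; one disc therefore serves every \<open>m\<close>.\<close>
      have avoid: "fcomp (b # ys) 0 \<notin> ball z d" if "rep m = xs @ b # ys" for xs b ys
      proof -
        have "set (b # ys) \<subseteq> A" using rep(2)[of m] cs(1) that by auto
        then show ?thesis using fcomp_in[OF _ zero] d(2) by blast
      qed
      obtain h where "h holomorphic_on ball z d" "h (fcomp (rep m) z) = z"
          "\<And>u. u \<in> ball z d \<Longrightarrow> fcomp (rep m) (h u) = u"
        by (rule fcomp_inverse_branch[of "ball z d" "rep m" z])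
          (use avoid d(1) in \<open>auto simp: rep_z convex_imp_contractible\<close>)
      then show ?thesis using rep_z by metis
    qed
    then obtain h where h: "\<And>m. h m holomorphic_on ball z d" "\<And>m. h m z = z"
        "\<And>m u. u \<in> ball z d \<Longrightarrow> fcomp (rep m) (h m u) = u"
      by metis
    have "cmod (h m u) \<le> R" if "u \<in> ball z d" for m u
    proof (rule norm_fcomp_inverse_branch_le[of "rep m" C _ u])
      show "\<forall>a\<in>set (rep m). cmod a \<le> C" using C rep(2) by blast
      show "cmod u \<le> R"
        using that norm_triangle_ineq2[of u z] by (simp add: R_def dist_norm norm_minus_commute)
    qed (use h(3)[OF that] d(1) in \<open>auto simp: R_def intro: add_increasing2\<close>)
    then show False
      using no_bounded_inverse_branches[OF holomorphic_fcomp
          fcomp_minus_id_not_constant[OF cs(2) fix_z] fix_z der d(1), of h R] h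
      by (simp add: rep)
  qed
qed

end

section \<open>The bifurcation radius\<close>

text \<open>Adding \<open>v - fq a w\<close> to the parameter moves the value at \<open>w\<close> to
  \<open>v\<close>; the larger disc has room \<open>r - r0\<close> for this shift.\<close>

lemma absorbing_if_forward_invariant:
  assumes "r0 < r" "compact L" "L \<noteq> {}" "forward_invariant (Gsemi c r) L"
  shows "absorbing (cball c r0) L (r - r0)"
proof
  fix a w assume "a \<in> cball c r0" "w \<in> L"
  show "cball (fq a w) (r - r0) \<subseteq> L"
  proof
    fix v assume v: "v \<in> cball (fq a w) (r - r0)"
    let ?a = "a + (v - fq a w)"
    have "cmod (?a - c) \<le> cmod (a - c) + cmod (v - fq a w)"
      by (metis add_diff_eq add.commute diff_add_eq norm_triangle_ineq)
    also have "\<dots> \<le> r"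
      using \<open>a \<in> cball c r0\<close> v by (simp add: dist_norm norm_minus_commute)
    finally have "fq ?a \<in> Gsemi c r" by (rule Gsemi.gen)
    then have "fq ?a w \<in> L"
      using assms(4) \<open>w \<in> L\<close> by (auto simp: forward_invariant_def)
    then show "v \<in> L" by (simp add: fq_def)
  qed
qed (use assms in auto)

text \<open>Repeating the word \<open>q\<close> times makes the point fixed; repeating the result
  \<open>n\<close> times raises the multiplier to 1.\<close>

lemma parabolic_fcomp_iterate:
  assumes "cs \<noteq> []" "parabolic_periodic_point (fcomp cs) z"
  obtains ds where "ds \<noteq> []" "set ds \<subseteq> set cs" "fcomp ds z = z"
    "(fcomp ds has_field_derivative 1) (at z)"
proof -
  obtain q n where q: "q \<ge> 1" "(fcomp cs ^^ q) z = z"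
    and n: "n \<ge> 1" "deriv (fcomp cs ^^ q) z ^ n = 1"
    using assms(2) by (auto simp: parabolic_periodic_point_def)
  define es where "es = concat (replicate q cs)"
  define ds where "ds = concat (replicate n es)"
  have es: "fcomp es = fcomp cs ^^ q" by (simp add: es_def fcomp_concat_replicate)
  have iter: "(fcomp es ^^ m) z = z" for m by (induction m) (auto simp: es q)
  have "((fcomp es ^^ n) has_field_derivative deriv (fcomp es) z ^ n) (at z)"
    by (rule has_field_derivative_funpow_fixpoint)
      (use iter[of 1] in \<open>auto simp: DERIV_deriv_iff_field_differentiable field_differentiable_fcomp\<close>)
  moreover have "fcomp ds = fcomp es ^^ n" by (simp add: ds_def fcomp_concat_replicate)
  ultimately have "(fcomp ds has_field_derivative 1) (at z)"
    using n(2) by (simp only: es)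
  moreover have "fcomp ds z = z" by (simp add: ds_def fcomp_concat_replicate iter)
  moreover have "ds \<noteq> []" "set ds \<subseteq> set cs"
    using assms(1) q(1) n(1) by (auto simp: ds_def es_def)
  ultimately show ?thesis using that by blast
qed

theorem theorem4p19:
  fixes c :: complex and r0 :: real and cs :: "complex list"
  assumes "r0 \<ge> 0"
    and "\<exists>ct \<in> cball c r0. superattracting ct"
    and "cs \<noteq> []"
    and "set cs \<subseteq> cball c r0"
    and "\<exists>z. parabolic_periodic_point (fcomp cs) z"
  shows "r_bif c \<le> ereal r0"
proof -
  obtain z ds where ds: "ds \<noteq> []" "set ds \<subseteq> cball c r0" "fcomp ds z = z"
      "(fcomp ds has_field_derivative 1) (at z)"
    using assms(3-5) parabolic_fcomp_iterate by (metis subset_trans)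
  \<comment> \<open>The supremum is bounded radius by radius: beyond \<open>r0\<close>,
    \<open>L\<close> would be absorbing for \<open>cball c r0\<close> with positive margin.\<close>
  have "r \<le> r0" if "planar_minimal_set (Gsemi c r) L" for r L
  proof (rule ccontr)
    assume "\<not> r \<le> r0"
    then interpret absorbing "cball c r0" L "r - r0"
      using that by (intro absorbing_if_forward_invariant) (auto simp: planar_minimal_set_def)
    have "0 \<in> L" using assms(2) zero_in_if_superattracting by blast
    with ds show False using no_fixed_point_with_multiplier_one by blast
  qed
  then show ?thesis unfolding r_bif_def by (intro Sup_least) auto
qed

end
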